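(* Let $\alpha$ be a finite set with an involution $\tau:\alpha\to\alpha$, let $\mathrm{crs}(\alpha/\tau)$ be a complete system of representatives of the orbits of $\tau$, and let $L\subset\mathrm{crs}(\alpha/\tau)$ be an arbitrary nonempty subset. For any two nanophrases $(\mathcal A_1,P_1)$ and $(\mathcal A_2,P_2)$ over $\alpha$, $$(\mathcal A_1,P_1)\simeq_{\Delta_\alpha}(\mathcal A_2,P_2)\ \Longrightarrow\ \mathcal U_L((\mathcal A_1,P_1))\simeq_{S_0}\mathcal U_L((\mathcal A_2,P_2)).$$
   Context: Nanophrases. An $\alpha$-alphabet is a finite set $\mathcal A$ with a map (projection) $\mathcal A\to\alpha$, $A\mapsto |A|$. A Gauss phrase in an alphabet is a finite sequence of (possibly empty) words $w_1|\cdots|w_k$ such that each letter of the alphabet occurs exactly twice in $w_1w_2\cdots w_k$. A nanophrase of length $k$ over $\alpha$ is a pair $(\mathcal A, w_1|\cdots|w_k)$ with $\mathcal A$ an $\alpha$-alphabet and $w_1|\cdots|w_k$ a Gauss phrase in $\mathcal A$; the $w_i$ are its components. An isomorphism of nanophrases is a projection-preserving bijection of alphabets carrying each component to the corresponding component. $S$-homotopy. Let $\tau:\alpha\to\alpha$ be an involution and $S\subset\alpha^3$. Two nanophrases over $\alpha$ are $S$-homotopic, written $\simeq_S$, if they are related by a finite sequence of isomorphisms, the following moves, and their inverses (here $x,y,z,t$ are words not containing the displayed letters $A,B,C$, possibly including the separator $|$, such that what remains after removing the displayed letters is a Gauss phrase): (H1) $(\mathcal A,xAAy)\to(\mathcal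 A\setminus\{A\},xy)$; (H2) $(\mathcal A,xAByBAz)\to(\mathcal A\setminus\{A,B\},xyz)$ if $\tau(|A|)=|B|$; (H3) $(\mathcal A,xAByACzBCt)\to(\mathcal A,xBAyCAzCBt)$ if $(|A|,|B|,|C|)\in S$. $\Delta_\alpha=\{(a,a,a)\mid a\in\alpha\}$. $\alpha_0=\{-1,1\}$ with involution $\tau_0:\pm1\mapsto\mp1$, and $S_0=\{(-1,-1,-1),(1,1,1)\}$; $\simeq_{S_0}$ is taken for nanophrases over $\alpha_0$ with $\tau_0$. The map $\mathcal U_L$. An orbit of $\tau$ is free if it has two elements. For a letter $A$ of an $\alpha$-alphabet put $\mathrm{sign}_L(A)=1$ if $|A|\in L$ and the orbit of $|A|$ is free, $\mathrm{sign}_L(A)=-1$ if $|A|\in\tau(L)$ and the orbit of $|A|$ is free, and $\mathrm{sign}_L(A)=0$ otherwise. For a nanophrase $(\mathcal A,P)$ of length $k$ over $\alpha$, $\mathcal U_L((\mathcal A,P))$ is the nanophrase of length $k$ over $\alpha_0$ obtained by removing from $P$ all letters $A$ with $\mathrm{sign}_L(A)=0$ and then replacing each remaining letter $A$ by a new letter with projection $\mathrm{sign}_L(A)\in\{1,-1\}$ (distinct letters being replaced by distinct letters). *)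

theory Defs
  imports Main "HOL-Library.FuncSet" "HOL-Library.Infinite_Typeclass"
begin

text \<open>The map \<open>projection P\<close> only matters on \<open>alphabet P\<close>.\<close>

record ('l, 'a) nanophrase =
  alphabet :: "'l set"
  projection :: "'l \<Rightarrow> 'a"
  components :: "'l list list"

definition gauss_phrase :: "'l set \<Rightarrow> 'l list list \<Rightarrow> bool" where
  "gauss_phrase \<A> ws \<longleftrightarrow>
     set (concat ws) \<subseteq> \<A> \<and> (\<forall>A\<in>\<A>. count_list (concat ws) A = 2)"

definition nanophrase_over :: "'a set \<Rightarrow> ('l, 'a) nanophrase \<Rightarrow> bool" where
  "nanophrase_over \<alpha> P \<longleftrightarrow>
     finite (alphabet P) \<and> projection P \<in> alphabet P \<rightarrow> \<alpha> \<and>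
     gauss_phrase (alphabet P) (components P)"

definition nanophrase_iso :: "('l, 'a) nanophrase \<Rightarrow> ('l, 'a) nanophrase \<Rightarrow> bool" where
  "nanophrase_iso P Q \<longleftrightarrow>
     (\<exists>f. bij_betw f (alphabet P) (alphabet Q) \<and>
          (\<forall>A\<in>alphabet P. projection Q (f A) = projection P A) \<and>
          components Q = map (map f) (components P))"

text \<open>
  A phrase is spelled out as a single word in letters and separators, so that the contexts
  \<open>x, y, z, t\<close> of a move may run across several components. The separator is placed after
  every component, the last one included: this makes the spelling injective also on the phrase
  without components. The final separator always lies in the last context of a move.
\<close>

datatype 'l symbol = Letter 'l | Separator

definition spell :: "'l list list \<Rightarrow> 'l symbol list" where
  "spell ws = concat (map (\<lambda>w. map Letter w @ [Separator]) ws)"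

text \<open>
  Both sides of a move are required to be nanophrases. By the Gauss condition on the left-hand
  side, the displayed letters are then pairwise distinct and do not occur in the contexts.
\<close>

inductive homotopy_step ::
  "'a set \<Rightarrow> ('a \<Rightarrow> 'a) \<Rightarrow> ('a \<times> 'a \<times> 'a) set \<Rightarrow>
   ('l, 'a) nanophrase \<Rightarrow> ('l, 'a) nanophrase \<Rightarrow> bool"
  for \<alpha> \<tau> S where
  Iso: "\<lbrakk>nanophrase_over \<alpha> P; nanophrase_over \<alpha> Q; nanophrase_iso P Q\<rbrakk>
    \<Longrightarrow> homotopy_step \<alpha> \<tau> S P Q"
| H1: "\<lbrakk>nanophrase_over \<alpha> P; nanophrase_over \<alpha> Q;
     spell (components P) = x @ [Letter A, Letter A] @ y;
     spell (components Q) = x @ y;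
     alphabet Q = alphabet P - {A};
     \<forall>X\<in>alphabet Q. projection Q X = projection P X\<rbrakk>
    \<Longrightarrow> homotopy_step \<alpha> \<tau> S P Q"
| H2: "\<lbrakk>nanophrase_over \<alpha> P; nanophrase_over \<alpha> Q;
     spell (components P) = x @ [Letter A, Letter B] @ y @ [Letter B, Letter A] @ z;
     spell (components Q) = x @ y @ z;
     alphabet Q = alphabet P - {A, B};
     \<forall>X\<in>alphabet Q. projection Q X = projection P X;
     \<tau> (projection P A) = projection P B\<rbrakk>
    \<Longrightarrow> homotopy_step \<alpha> \<tau> S P Q"
| H3: "\<lbrakk>nanophrase_over \<alpha> P; nanophrase_over \<alpha> Q;
     spell (components P) =
       x @ [Letter A, Letter B] @ y @ [Letter A, Letter C] @ z @ [Letter B, Letter C] @ t;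
     spell (components Q) =
       x @ [Letter B, Letter A] @ y @ [Letter C, Letter A] @ z @ [Letter C, Letter B] @ t;
     alphabet Q = alphabet P;
     \<forall>X\<in>alphabet Q. projection Q X = projection P X;
     (projection P A, projection P B, projection P C) \<in> S\<rbrakk>
    \<Longrightarrow> homotopy_step \<alpha> \<tau> S P Q"

text \<open>
  Moves and their inverses add and remove letters from the type \<open>'l\<close>. It is taken infinite so
  that fresh letters are always available.
\<close>

definition homotopic ::
  "'a set \<Rightarrow> ('a \<Rightarrow> 'a) \<Rightarrow> ('a \<times> 'a \<times> 'a) set \<Rightarrow>
   ('l::infinite, 'a) nanophrase \<Rightarrow> ('l, 'a) nanophrase \<Rightarrow> bool" where
  "homotopic \<alpha> \<tau> S P Q \<longleftrightarrow>
     nanophrase_over \<alpha> P \<and> nanophrase_over \<alpha> Q \<and> equivclp (homotopy_step \<alpha> \<tau> S) P Q"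

definition diagonal :: "'a set \<Rightarrow> ('a \<times> 'a \<times> 'a) set" where
  "diagonal \<alpha> = {(a, a, a) | a. a \<in> \<alpha>}"

definition \<alpha>\<^sub>0 :: "int set" where
  "\<alpha>\<^sub>0 = {-1, 1}"

definition \<tau>\<^sub>0 :: "int \<Rightarrow> int" where
  "\<tau>\<^sub>0 a = - a"

definition S\<^sub>0 :: "(int \<times> int \<times> int) set" where
  "S\<^sub>0 = {(-1, -1, -1), (1, 1, 1)}"

definition involution_on :: "'a set \<Rightarrow> ('a \<Rightarrow> 'a) \<Rightarrow> bool" where
  "involution_on \<alpha> \<tau> \<longleftrightarrow> \<tau> \<in> \<alpha> \<rightarrow> \<alpha> \<and> (\<forall>a\<in>\<alpha>. \<tau> (\<tau> a) = a)"

definition inv_orbit :: "('a \<Rightarrow> 'a) \<Rightarrow> 'a \<Rightarrow> 'a set" where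
  "inv_orbit \<tau> a = {a, \<tau> a}"

definition free_orbit :: "'a set \<Rightarrow> bool" where
  "free_orbit X \<longleftrightarrow> card X = 2"

definition complete_representatives :: "'a set \<Rightarrow> ('a \<Rightarrow> 'a) \<Rightarrow> 'a set \<Rightarrow> bool" where
  "complete_representatives \<alpha> \<tau> R \<longleftrightarrow>
     R \<subseteq> \<alpha> \<and> (\<forall>X \<in> inv_orbit \<tau> ` \<alpha>. \<exists>!r. r \<in> R \<and> r \<in> X)"

definition sign :: "('a \<Rightarrow> 'a) \<Rightarrow> 'a set \<Rightarrow> ('l, 'a) nanophrase \<Rightarrow> 'l \<Rightarrow> int" where
  "sign \<tau> L P A =
     (let a = projection P A in
      if a \<in> L \<and> free_orbit (inv_orbit \<tau> a) then 1
      else if a \<in> \<tau> ` L \<and> free_orbit (inv_orbit \<tau> a) then -1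
      else 0)"

text \<open>
  The new letters replacing the remaining ones are only determined up to isomorphism; each
  remaining letter is replaced by itself, equipped with the new projection.
\<close>

definition \<U> ::
  "('a \<Rightarrow> 'a) \<Rightarrow> 'a set \<Rightarrow> ('l, 'a) nanophrase \<Rightarrow> ('l, int) nanophrase" where
  "\<U> \<tau> L P =
     \<lparr>alphabet = {A \<in> alphabet P. sign \<tau> L P A \<noteq> 0},
      projection = sign \<tau> L P,
      components = map (filter (\<lambda>A. sign \<tau> L P A \<noteq> 0)) (components P)\<rparr>"

end

theory Submission
  imports Defs
begin

text \<open>
  The map \<open>\<U>\<close> sends a single step to a single step. The sign of a letter depends only on its
  projection and changes by a factor of \<open>-1\<close> under \<open>\<tau>\<close>, so the letters displayed in a move are
  either all kept or all removed: for H2 because opposite signs vanish together, for H3 because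
  over the diagonal the three projections coincide. If they are kept, the move survives; if they
  are removed, both sides become the same phrase.
\<close>

text \<open>Separators always survive, so filtering the spelled word deletes letters without merging
  components.\<close>

definition keep_symbol :: "('l \<Rightarrow> bool) \<Rightarrow> 'l symbol \<Rightarrow> bool" where
  "keep_symbol p c = (case c of Letter A \<Rightarrow> p A | Separator \<Rightarrow> True)"

lemma keep_symbol_simps [simp]:
  "keep_symbol p (Letter A) = p A" "keep_symbol p Separator"
  by (simp_all add: keep_symbol_def)

lemma spell_Nil [simp]: "spell [] = []"
  and spell_Cons [simp]: "spell (w # ws) = map Letter w @ Separator # spell ws"
  by (simp_all add: spell_def)

lemma filter_map_Letter:
  "filter (keep_symbol p) (map Letter w) = map Letter (filter p w)"
  by (induction w) auto

lemma spell_map_filter: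
  "spell (map (filter p) ws) = filter (keep_symbol p) (spell ws)"
  by (induction ws) (auto simp: filter_map_Letter)

text \<open>The first separator marks where the first component ends, so that component can be split
  off in only one way.\<close>

lemma map_Letter_append_Separator_eq:
  "map Letter v @ Separator # r = map Letter w @ Separator # s \<longleftrightarrow> v = w \<and> r = s"
proof (induction v arbitrary: w)
  case Nil
  then show ?case by (cases w) auto
next
  case (Cons a v)
  then show ?case by (cases w) auto
qed

lemma spell_inject: "spell vs = spell ws \<longleftrightarrow> vs = ws"
proof (induction vs arbitrary: ws)
  case Nil
  then show ?case by (cases ws) auto
next
  case (Cons v vs)
  then show ?case by (cases ws) (auto simp: map_Letter_append_Separator_eq)
qed

lemma Letter_in_spell: "Letter A \<in> set (spell ws) \<longleftrightarrow> A \<in> set (concat ws)"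
  by (induction ws) auto

lemma count_list_filter: "count_list (filter p xs) x = (if p x then count_list xs x else 0)"
  by (induction xs) auto

text \<open>Since \<open>p\<close> depends only on the letter, its two occurrences are kept or
  removed together.\<close>

lemma gauss_phrase_filter:
  assumes "gauss_phrase \<A> ws"
  shows "gauss_phrase {A \<in> \<A>. p A} (map (filter p) ws)"
  using assms by (auto simp: gauss_phrase_def count_list_filter simp flip: filter_concat)

lemma letter_in_alphabet:
  assumes "nanophrase_over \<alpha> P" "Letter A \<in> set (spell (components P))"
  shows "A \<in> alphabet P"
  using assms unfolding nanophrase_over_def gauss_phrase_def Letter_in_spell by blast

text \<open>The identity is an isomorphism here. \<open>P\<close> and \<open>Q\<close> may still
  differ as records, because projections are compared only on the alphabet. This covers the moves
  whose displayed letters are all deleted by \<open>\<U>\<close>.\<close>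

lemma homotopy_step_same_phrase:
  assumes "nanophrase_over \<alpha> P" "nanophrase_over \<alpha> Q"
    and "spell (components P) = spell (components Q)" "alphabet P = alphabet Q"
    and "\<forall>A\<in>alphabet Q. projection Q A = projection P A"
  shows "homotopy_step \<alpha> \<tau> S P Q"
proof (rule homotopy_step.Iso)
  show "nanophrase_iso P Q"
    unfolding nanophrase_iso_def
    by (rule exI [where x = id]) (use assms in \<open>auto simp: spell_inject\<close>)
qed (use assms in auto)

text \<open>Detaching the sign from the nanophrase lets signs be compared between nanophrases whose
  projections agree.\<close>

definition sign_of :: "('a \<Rightarrow> 'a) \<Rightarrow> 'a set \<Rightarrow> 'a \<Rightarrow> int" where
  "sign_of \<tau> L a =
     (if a \<in> L \<and> free_orbit (inv_orbit \<tau> a) then 1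
      else if a \<in> \<tau> ` L \<and> free_orbit (inv_orbit \<tau> a) then -1
      else 0)"

lemma sign_conv: "sign \<tau> L P A = sign_of \<tau> L (projection P A)"
  by (simp add: sign_def sign_of_def Let_def)

lemma sign_of_in_\<alpha>\<^sub>0: "sign_of \<tau> L a \<noteq> 0 \<Longrightarrow> sign_of \<tau> L a \<in> \<alpha>\<^sub>0"
  by (simp add: sign_of_def \<alpha>\<^sub>0_def split: if_splits)

lemma free_inv_orbit: "free_orbit (inv_orbit \<tau> a) \<longleftrightarrow> \<tau> a \<noteq> a"
  by (auto simp: free_orbit_def inv_orbit_def card_2_iff)

text \<open>On a fixed point both sides are 0. A free orbit contains at most one element of
  \<open>L\<close>, and \<open>\<tau>\<close> exchanges it with the other element of the orbit,
  which lies in the image of \<open>L\<close>.\<close>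

lemma sign_of_involution:
  assumes inv: "involution_on \<alpha> \<tau>" and crs: "complete_representatives \<alpha> \<tau> crs"
    and L: "L \<subseteq> crs" and a: "a \<in> \<alpha>"
  shows "sign_of \<tau> L (\<tau> a) = - sign_of \<tau> L a"
proof -
  have \<tau>\<tau>: "\<tau> (\<tau> b) = b" if "b \<in> \<alpha>" for b
    using inv that by (auto simp: involution_on_def)
  have L\<alpha>: "L \<subseteq> \<alpha>"
    using crs L by (auto simp: complete_representatives_def)
  \<comment> \<open>Both elements would represent the same orbit, so uniqueness of representatives
    identifies them.\<close>
  have distinct: "\<tau> b = b" if "b \<in> L" "\<tau> b \<in> L" for b
  proof -
    have "\<exists>!r. r \<in> crs \<and> r \<in> inv_orbit \<tau> b"
      using crs L\<alpha> that unfolding complete_representatives_def by blast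
    then show ?thesis
      using that L by (auto simp: inv_orbit_def)
  qed
  have image: "c \<in> \<tau> ` L \<longleftrightarrow> \<tau> c \<in> L" if "c \<in> \<alpha>" for c
    using \<tau>\<tau> that L\<alpha> by (metis image_iff subsetD)
  have "\<tau> a \<in> \<alpha>"
    using inv a by (auto simp: involution_on_def)
  then show ?thesis
    using image a \<tau>\<tau> distinct unfolding sign_of_def free_inv_orbit by auto
qed

lemma nanophrase_over_\<U>:
  assumes "nanophrase_over \<alpha> P"
  shows "nanophrase_over \<alpha>\<^sub>0 (\<U> \<tau> L P)"
  using assms
  by (auto simp: nanophrase_over_def \<U>_def gauss_phrase_filter sign_conv sign_of_in_\<alpha>\<^sub>0)

lemma projection_\<U> [simp]: "projection (\<U> \<tau> L P) A = sign \<tau> L P A"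
  by (simp add: \<U>_def)

lemma alphabet_\<U>:
  assumes "\<forall>A\<in>alphabet Q. projection Q A = projection P A"
  shows "alphabet (\<U> \<tau> L Q) = {A \<in> alphabet Q. sign \<tau> L P A \<noteq> 0}"
  using assms by (auto simp: \<U>_def sign_conv)

text \<open>Taking the signs from \<open>P\<close> instead of \<open>Q\<close> lets one filter act
  on both sides of a move, so it distributes over the contexts they share.\<close>

lemma spell_\<U>:
  assumes "nanophrase_over \<alpha> Q" "\<forall>A\<in>alphabet Q. projection Q A = projection P A"
  shows "spell (components (\<U> \<tau> L Q)) =
    filter (keep_symbol (\<lambda>A. sign \<tau> L P A \<noteq> 0)) (spell (components Q))"
proof -
  have "sign \<tau> L Q A = sign \<tau> L P A" if "Letter A \<in> set (spell (components Q))" for A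
    using assms(2) letter_in_alphabet [OF assms(1) that] by (simp add: sign_conv)
  then have "filter (keep_symbol (\<lambda>A. sign \<tau> L Q A \<noteq> 0)) (spell (components Q)) =
      filter (keep_symbol (\<lambda>A. sign \<tau> L P A \<noteq> 0)) (spell (components Q))"
    by (intro filter_cong) (auto simp: keep_symbol_def split: symbol.splits)
  then show ?thesis
    by (simp add: \<U>_def spell_map_filter)
qed

text \<open>An isomorphism preserves projections, hence signs, so the same \<open>f\<close>
  restricts to a bijection between the surviving letters.\<close>

lemma nanophrase_iso_\<U>:
  assumes "nanophrase_over \<alpha> P" "nanophrase_iso P Q"
  shows "nanophrase_iso (\<U> \<tau> L P) (\<U> \<tau> L Q)"
proof -
  obtain f where f: "bij_betw f (alphabet P) (alphabet Q)"
      "\<forall>A\<in>alphabet P. projection Q (f A) = projection P A"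
      "components Q = map (map f) (components P)"
    using assms(2) by (auto simp: nanophrase_iso_def)
  have sign: "sign \<tau> L Q (f A) = sign \<tau> L P A" if "A \<in> alphabet P" for A
    using f(2) that by (simp add: sign_conv)
  have "bij_betw f (alphabet (\<U> \<tau> L P)) (alphabet (\<U> \<tau> L Q))"
    using f(1) sign by (fastforce simp: \<U>_def bij_betw_def intro: inj_on_subset)
  moreover have "filter (\<lambda>A. sign \<tau> L Q A \<noteq> 0) (map f w) =
      map f (filter (\<lambda>A. sign \<tau> L P A \<noteq> 0) w)" if "w \<in> set (components P)" for w
  proof -
    have "set w \<subseteq> alphabet P"
      using assms(1) that by (auto simp: nanophrase_over_def gauss_phrase_def)
    then show ?thesis
      using sign by (auto simp: filter_map intro!: arg_cong [where f = "map f"] filter_cong)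
  qed
  ultimately show ?thesis
    using f(3) sign unfolding nanophrase_iso_def \<U>_def by (intro exI [where x = f]) auto
qed

lemma homotopy_step_\<U>:
  assumes inv: "involution_on \<alpha> \<tau>" and crs: "complete_representatives \<alpha> \<tau> crs"
    and L: "L \<subseteq> crs"
    and step: "homotopy_step \<alpha> \<tau> (diagonal \<alpha>) P Q"
  shows "homotopy_step \<alpha>\<^sub>0 \<tau>\<^sub>0 S\<^sub>0 (\<U> \<tau> L P) (\<U> \<tau> L Q)"
  using step
proof cases
  case Iso
  then show ?thesis
    by (intro homotopy_step.Iso nanophrase_iso_\<U> nanophrase_over_\<U>)
next
  case (H1 x A y)
  let ?k = "keep_symbol (\<lambda>A. sign \<tau> L P A \<noteq> 0)"
  note over = H1(1,2)[THEN nanophrase_over_\<U>, of \<tau> L]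
  note spells = spell_\<U>[OF H1(1), of P \<tau> L, simplified] spell_\<U>[OF H1(2,6), of \<tau> L]
  note alph = alphabet_\<U>[of P P \<tau> L, simplified] alphabet_\<U>[OF H1(6), of \<tau> L]
  have proj: "\<forall>X\<in>alphabet (\<U> \<tau> L Q). projection (\<U> \<tau> L Q) X = projection (\<U> \<tau> L P) X"
    using H1(6) by (simp add: alph sign_conv)
  show ?thesis
  proof (cases "sign \<tau> L P A = 0")
    case True
    then show ?thesis
      using over proj alph spells H1
      by (intro homotopy_step_same_phrase) auto
  next
    case False
    then show ?thesis
      using over proj alph spells H1
      by (intro homotopy_step.H1 [where x = "filter ?k x" and y = "filter ?k y" and A = A])
        auto
  qed
next
  case (H2 x A B y z)
  let ?k = "keep_symbol (\<lambda>A. sign \<tau> L P A \<noteq> 0)"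
  note over = H2(1,2)[THEN nanophrase_over_\<U>, of \<tau> L]
  note spells = spell_\<U>[OF H2(1), of P \<tau> L, simplified] spell_\<U>[OF H2(2,6), of \<tau> L]
  note alph = alphabet_\<U>[of P P \<tau> L, simplified] alphabet_\<U>[OF H2(6), of \<tau> L]
  have proj: "\<forall>X\<in>alphabet (\<U> \<tau> L Q). projection (\<U> \<tau> L Q) X = projection (\<U> \<tau> L P) X"
    using H2(6) by (simp add: alph sign_conv)
  \<comment> \<open>The sign rule for \<open>\<tau>\<close> is available only on \<alpha>, so the
    projection of \<open>A\<close> must be shown to lie there.\<close>
  have "A \<in> alphabet P"
    using letter_in_alphabet [OF H2(1)] H2(3) by simp
  then have "projection P A \<in> \<alpha>"
    using H2(1) by (auto simp: nanophrase_over_def)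
  then have sign: "sign \<tau> L P B = - sign \<tau> L P A"
    using sign_of_involution [OF inv crs L] H2(7) by (simp add: sign_conv flip: H2(7))
  show ?thesis
  proof (cases "sign \<tau> L P A = 0")
    case True
    then show ?thesis
      using over proj alph spells H2 sign
      by (intro homotopy_step_same_phrase) auto
  next
    case False
    then show ?thesis
      using over proj alph spells H2 sign
      by (intro homotopy_step.H2 [where x = "filter ?k x" and y = "filter ?k y"
            and z = "filter ?k z" and A = A and B = B])
        (auto simp: \<tau>\<^sub>0_def)
  qed
next
  case (H3 x A B y C z t)
  let ?k = "keep_symbol (\<lambda>A. sign \<tau> L P A \<noteq> 0)"
  note over = H3(1,2)[THEN nanophrase_over_\<U>, of \<tau> L]
  note spells = spell_\<U>[OF H3(1), of P \<tau> L, simplified] spell_\<U>[OF H3(2,6), of \<tau> L]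
  note alph = alphabet_\<U>[of P P \<tau> L, simplified] alphabet_\<U>[OF H3(6), of \<tau> L]
  have proj: "\<forall>X\<in>alphabet (\<U> \<tau> L Q). projection (\<U> \<tau> L Q) X = projection (\<U> \<tau> L P) X"
    using H3(6) by (simp add: alph sign_conv)
  have sign: "sign \<tau> L P B = sign \<tau> L P A" "sign \<tau> L P C = sign \<tau> L P A"
    using H3(7) by (auto simp: diagonal_def sign_conv)
  show ?thesis
  proof (cases "sign \<tau> L P A = 0")
    case True
    then show ?thesis
      using over proj alph spells H3 sign
      by (intro homotopy_step_same_phrase) auto
  next
    case False
    then have "sign \<tau> L P A \<in> \<alpha>\<^sub>0"
      by (simp add: sign_conv sign_of_in_\<alpha>\<^sub>0)
    \<comment> \<open>\<open>S\<^sub>0\<close> is the diagonal of \<open>\<alpha>\<^sub>0\<close>,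
      so three equal nonzero signs form one of its triples.\<close>
    then have "(sign \<tau> L P A, sign \<tau> L P B, sign \<tau> L P C) \<in> S\<^sub>0"
      using sign by (auto simp: \<alpha>\<^sub>0_def S\<^sub>0_def)
    then show ?thesis
      using over proj alph spells H3 sign False
      by (intro homotopy_step.H3 [where x = "filter ?k x" and y = "filter ?k y"
            and z = "filter ?k z" and t = "filter ?k t" and A = A and B = B and C = C]) auto
  qed
qed

theorem theorem6p1:
  fixes \<alpha> :: "'a set" and \<tau> :: "'a \<Rightarrow> 'a" and crs L :: "'a set"
    and P\<^sub>1 P\<^sub>2 :: "('l::infinite, 'a) nanophrase"
  assumes "finite \<alpha>"
    and "involution_on \<alpha> \<tau>"
    and "complete_representatives \<alpha> \<tau> crs"
    and "L \<subseteq> crs" and "L \<noteq> {}"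
    and "nanophrase_over \<alpha> P\<^sub>1" and "nanophrase_over \<alpha> P\<^sub>2"
    and "homotopic \<alpha> \<tau> (diagonal \<alpha>) P\<^sub>1 P\<^sub>2"
  shows "homotopic \<alpha>\<^sub>0 \<tau>\<^sub>0 S\<^sub>0 (\<U> \<tau> L P\<^sub>1) (\<U> \<tau> L P\<^sub>2)"
proof -
  have "equivclp (homotopy_step \<alpha> \<tau> (diagonal \<alpha>)) P\<^sub>1 P\<^sub>2"
    using assms(8) by (simp add: homotopic_def)
  then have "equivclp (homotopy_step \<alpha>\<^sub>0 \<tau>\<^sub>0 S\<^sub>0) (\<U> \<tau> L P\<^sub>1) (\<U> \<tau> L P\<^sub>2)"
  proof (induction rule: equivclp_induct)
    case base
    show ?case by simp
  next
    case (step Q R)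
    then show ?case
      \<comment> \<open>The last step may run from \<open>Q\<close> to \<open>R\<close> or from
        \<open>R\<close> to \<open>Q\<close>; in either case its image under \<open>\<U>\<close> is
        a step in the same direction.\<close>
      by (metis homotopy_step_\<U> [OF assms(2-4)] equivclp_into_equivclp)
  qed
  then show ?thesis
    using assms(6,7) by (simp add: homotopic_def nanophrase_over_\<U>)
qed

end
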